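(* Let A1, A2, A3 and A4 (stated in the context) hold true. For each fixed $k\in\mathbb{N}$, the element $x_k^\delta$, computed after $k$ iterations of any method within the family of noisy-data relaxed projection Landweber methods (defined in the context; a method of the family is given by a choice of relaxation parameters $\theta_j\in(0,2)$), depends continuously on the data $y^\delta$.
   Context: $X,Y$ are Hilbert spaces, $F:D(F)\subset X\to Y$ is a (nonlinear, ill-posed) operator, $y\in Y$ is the exact data, and $y^\delta\in Y$ is noisy data with $\|y^\delta-y\|\le\delta$, where the noise level $\delta>0$ is known. Write $F_\delta(x):=F(x)-y^\delta$. $B_r(z)$ denotes the ball of radius $r$ centered at $z$ in $X$. A1: $F$ is continuous on $D(F)$, which has nonempty interior; there are constants $C,\rho>0$ and $x_0\in D(F)$ such that the Gateaux derivative $F'$ of $F$ is defined on $B_\rho(x_0)\subset D(F)$ and $\|F'(x)\|\le C$ for $x\in B_\rho(x_0)$. (The point $x_0$ is used as initial guess.) A2 (local tangential cone condition): for some $\eta<1$, $\|F(\bar x)-F(x)-F'(x)(\bar x-x)\|\le\eta\|F(\bar x)-F(x)\|$ for all $x,\bar x\in B_\rho(x_0)$. A3: there is $x^\star\in B_{\rho/2}(x_0)$ with $F(x^\star)=y$, where $y$ is the exact data. A4: $F$ is continuously Fréchet differentiable on $B_\rho(x_0)$. Family of noisy-data relaxed projection Landweber methods: $x_0^\delta:=x_0$ and $$x_{j+1}^\delta:=x_j^\delta-\theta_j\,\frac{p_\delta(\|F_\delta(x_j^\delta)\|)}{\|F'(x_j^\delta)^*F_\delta(x_j^\delta)\|^2}\,F'(x_j^\delta)^*F_\delta(x_j^\delta),\qquad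 \theta_j\in(0,2),$$ where $p_\delta(t):=t\big((1-\eta)t-(1+\eta)\delta\big)$. The computation is stopped at the index $k_*^\delta:=\max\{k\in\mathbb{N}:\ \|F_\delta(x_j^\delta)\|>\tau\delta,\ j=0,\dots,k-1\}$, with a fixed $\tau>(1+\eta)/(1-\eta)$ (discrepancy principle); the iterates are well defined for $k=0,\dots,k_*^\delta$. *)

theory Defs
  imports "HOL-Analysis.Analysis" "HOL-Library.Extended_Nat"
begin

text \<open>
  Hilbert spaces are real Hilbert spaces, i.e. types of sort \<open>{real_inner, banach}\<close>.  A partially
  defined operator is a total function together with its domain.
\<close>

definition has_gateaux_derivative ::
  "('a::real_normed_vector \<Rightarrow> 'b::real_normed_vector) \<Rightarrow> ('a \<Rightarrow>\<^sub>L 'b) \<Rightarrow> 'a \<Rightarrow> bool"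
  where "has_gateaux_derivative F A x \<longleftrightarrow>
    (\<forall>h. ((\<lambda>t::real. (F (x + t *\<^sub>R h) - F x) /\<^sub>R t) \<longlongrightarrow> blinfun_apply A h) (at 0))"

definition p_noisy :: "real \<Rightarrow> real \<Rightarrow> real \<Rightarrow> real"
  where "p_noisy \<eta> \<delta> t = t * ((1 - \<eta>) * t - (1 + \<eta>) * \<delta>)"

definition residual_gradient ::
  "('a::real_inner \<Rightarrow> 'b::real_inner) \<Rightarrow> ('a \<Rightarrow> 'a \<Rightarrow>\<^sub>L 'b) \<Rightarrow> 'b \<Rightarrow> 'a \<Rightarrow> 'a"
  where "residual_gradient F F' yd x = adjoint (blinfun_apply (F' x)) (F x - yd)"

text \<open>
  The recursion is written as a total sequence.  Only the terms up to the stopping index are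
  iterates of the method; the later ones, and the value of the quotient when the gradient
  vanishes, carry no meaning.
\<close>

primrec relaxed_PLW ::
  "('a::real_inner \<Rightarrow> 'b::real_inner) \<Rightarrow> ('a \<Rightarrow> 'a \<Rightarrow>\<^sub>L 'b) \<Rightarrow> real \<Rightarrow> (nat \<Rightarrow> real) \<Rightarrow> 'a \<Rightarrow>
   real \<Rightarrow> 'b \<Rightarrow> nat \<Rightarrow> 'a"
  where
    "relaxed_PLW F F' \<eta> \<theta> x0 \<delta> yd 0 = x0"
  | "relaxed_PLW F F' \<eta> \<theta> x0 \<delta> yd (Suc j) =
      (let x = relaxed_PLW F F' \<eta> \<theta> x0 \<delta> yd j;
           g = residual_gradient F F' yd x
       in x - (\<theta> j * (p_noisy \<eta> \<delta> (norm (F x - yd)) / (norm g)\<^sup>2)) *\<^sub>R g)"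

text \<open>
  Discrepancy principle.  The set of admissible \<open>k\<close> contains 0, so the supremum in \<open>enat\<close> is
  its maximum when it is bounded.  It is \<open>\<infinity>\<close> when the iteration never stops, which can happen
  when the \<open>\<theta> j\<close> are not bounded away from 0 and 2.
\<close>

definition stopping_index ::
  "('a::real_inner \<Rightarrow> 'b::real_inner) \<Rightarrow> ('a \<Rightarrow> 'a \<Rightarrow>\<^sub>L 'b) \<Rightarrow> real \<Rightarrow> (nat \<Rightarrow> real) \<Rightarrow> 'a \<Rightarrow>
   real \<Rightarrow> real \<Rightarrow> 'b \<Rightarrow> enat"
  where "stopping_index F F' \<eta> \<theta> x0 \<tau> \<delta> yd =
    Sup (enat ` {k. \<forall>j<k. norm (F (relaxed_PLW F F' \<eta> \<theta> x0 \<delta> yd j) - yd) > \<tau> * \<delta>})"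

end

theory Submission
  imports Defs
begin

text \<open>
  Along the iteration the tangential cone condition gives
  \<open>p\<^sub>\<delta>(\<parallel>F\<^sub>\<delta>(x)\<parallel>) \<le> \<langle>x - x\<^sup>\<star>, F'(x)\<^sup>* F\<^sub>\<delta>(x)\<rangle>\<close>.  Before the stopping index the left-hand side is
  positive, so the gradient does not vanish, and for \<open>\<theta> \<in> (0,2)\<close> the step does not increase the
  distance to \<open>x\<^sup>\<star>\<close>, so the iterates stay in the ball where \<open>F\<close> and \<open>F'\<close> are continuous.  Hence every
  step is a continuous function of the current iterate and the data.  A negative \<open>\<eta>\<close> makes \<open>F\<close>
  constant on the ball and the iteration stationary.
\<close>

text \<open>The representing vector minimises \<open>\<parallel>x\<parallel>\<^sup>2 - 2 f x\<close>.\<close>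

lemma riesz_representation:
  fixes f :: "'a::{real_inner, banach} \<Rightarrow> real"
  assumes "bounded_linear f"
  shows "\<exists>v. \<forall>x. f x = x \<bullet> v"
proof -
  interpret f: bounded_linear f by fact
  define J where "J x = x \<bullet> x - 2 * f x" for x :: 'a
  obtain K where K: "\<And>x. norm (f x) \<le> norm x * K"
    using f.bounded by blast
  have bdd: "bdd_below (range J)"
  proof (rule bdd_belowI2)
    fix x :: 'a
    have "0 \<le> (norm x - K)\<^sup>2" by simp
    then have "2 * (norm x * K) \<le> x \<bullet> x + K\<^sup>2"
      by (simp add: power2_diff power2_norm_eq_inner)
    moreover have "f x \<le> norm x * K" using K[of x] by simp
    ultimately show "- K\<^sup>2 \<le> J x" by (simp add: J_def)
  qed
  define m where "m = Inf (range J)"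
  have m_le: "m \<le> J x" for x
    unfolding m_def using bdd by (simp add: cINF_lower)
  have "\<exists>x. J x < m + 1 / real (Suc n)" for n
    using cInf_lessD[of "range J" "m + 1 / real (Suc n)"] by (auto simp: m_def)
  then obtain X where X: "\<And>n. J (X n) < m + 1 / real (Suc n)" by metis
  \<comment> \<open>Twice the values at \<open>x\<close> and \<open>y\<close> minus four times the
    midpoint value cancels the linear terms and leaves the squared distance. The midpoint value is
    at least \<open>m\<close>, so near-minimisers are close together.\<close>
  have parallelogram: "(norm (x - y))\<^sup>2 \<le> 2 * (J x - m) + 2 * (J y - m)" for x y
  proof -
    have "4 * J ((1/2) *\<^sub>R (x + y)) = (x + y) \<bullet> (x + y) - 4 * f (x + y)"
      by (simp add: J_def f.scaleR)
    moreover have "(x + y) \<bullet> (x + y) = x \<bullet> x + 2 * (x \<bullet> y) + y \<bullet> y"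
      by (simp add: inner_add_left inner_add_right inner_commute[of y x])
    moreover have "(norm (x - y))\<^sup>2 = x \<bullet> x - 2 * (x \<bullet> y) + y \<bullet> y"
      by (simp add: power2_norm_eq_inner inner_diff_left inner_diff_right inner_commute[of y x])
    ultimately have "(norm (x - y))\<^sup>2 = 2 * J x + 2 * J y - 4 * J ((1/2) *\<^sub>R (x + y))"
      by (simp add: J_def f.add)
    then show ?thesis using m_le[of "(1/2) *\<^sub>R (x + y)"] by simp
  qed
  have "Cauchy X"
  proof (rule metric_CauchyI)
    fix e :: real
    assume e: "e > 0"
    then obtain N where N: "1 / real (Suc N) < e\<^sup>2 / 4"
      using reals_Archimedean[of "e\<^sup>2 / 4"] by (auto simp: inverse_eq_divide)
    have small: "J (X n) - m < e\<^sup>2 / 4" if "n \<ge> N" for n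
    proof -
      have "1 / real (Suc n) \<le> 1 / real (Suc N)" using that by (simp add: field_simps)
      then show ?thesis using X[of n] N by linarith
    qed
    have "dist (X i) (X j) < e" if "i \<ge> N" "j \<ge> N" for i j
    proof -
      have "(norm (X i - X j))\<^sup>2 < e\<^sup>2"
        using parallelogram[of "X i" "X j"] small[OF that(1)] small[OF that(2)] by simp
      then show ?thesis using e by (simp add: dist_norm power2_less_imp_less)
    qed
    then show "\<exists>M. \<forall>i\<ge>M. \<forall>j\<ge>M. dist (X i) (X j) < e" by blast
  qed
  then obtain v where v: "X \<longlonglongrightarrow> v"
    by (auto simp: Cauchy_convergent_iff convergent_def)
  have "(\<lambda>n. J (X n)) \<longlonglongrightarrow> J v"
    unfolding J_def by (intro tendsto_intros f.tendsto v)
  moreover have "(\<lambda>n. m + 1 / real (Suc n)) \<longlonglongrightarrow> m + 0"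
    by (intro tendsto_add tendsto_const LIMSEQ_Suc[OF lim_1_over_n])
  ultimately have "J v \<le> m + 0"
    by (rule LIMSEQ_le) (use X in \<open>auto intro: less_imp_le\<close>)
  then have min: "J v \<le> J x" for x using m_le[of x] by simp
  have "f h = h \<bullet> v" for h
  proof (cases "h = 0")
    case False
    define c where "c = v \<bullet> h - f h"
    \<comment> \<open>This \<open>t\<close> minimises the quadratic 2tc + t^2 (h . h); its least
      value -c^2 / (h . h) cannot be negative since \<open>v\<close> is a minimiser, which forces
      \<open>c = 0\<close>.\<close>
    define t where "t = - c / (h \<bullet> h)"
    have hh: "h \<bullet> h > 0" using False by simp
    have "J (v + t *\<^sub>R h) - J v = 2 * t * c + t\<^sup>2 * (h \<bullet> h)"
      by (simp add: J_def c_def f.add f.scaleR inner_add_left inner_add_right inner_commute[of h v]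
          power2_eq_square algebra_simps)
    also have "\<dots> = - c\<^sup>2 / (h \<bullet> h)"
      using hh by (simp add: t_def power2_eq_square field_simps)
    finally have "0 \<le> - c\<^sup>2 / (h \<bullet> h)" using min[of "v + t *\<^sub>R h"] by simp
    then have "c = 0" using hh by (simp add: divide_le_0_iff zero_le_divide_iff)
    then show ?thesis by (simp add: c_def inner_commute)
  qed simp
  then show ?thesis by blast
qed

text \<open>\<open>adjoint\<close> is defined by Hilbert choice, so its defining identity requires
  that some adjoint exists; the Riesz vectors of \<open>\<lambda>x. A x \<bullet> y\<close> provide
  one.\<close>

lemma adjoint_blinfun:
  fixes A :: "'a::{real_inner, banach} \<Rightarrow>\<^sub>L 'b::real_inner"
  shows "x \<bullet> adjoint (blinfun_apply A) y = A x \<bullet> y"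
proof -
  have "\<exists>v. \<forall>x. A x \<bullet> y = x \<bullet> v" for y
    by (rule riesz_representation)
      (intro bounded_linear_compose[OF bounded_linear_inner_left] blinfun.bounded_linear_right)
  then have "\<exists>g. \<forall>x y. A x \<bullet> y = x \<bullet> g y" by metis
  then have "\<forall>x y. A x \<bullet> y = x \<bullet> adjoint (blinfun_apply A) y"
    unfolding adjoint_def by (rule someI_ex)
  then show ?thesis by simp
qed

text \<open>Serves for joint continuity: in the residual gradient both the operator and the residual
  vary with the data. The norm bound comes from |A* y|^2 = <A A* y, y>.\<close>

lemma bounded_bilinear_adjoint_blinfun:
  "bounded_bilinear (\<lambda>(A :: 'a::{real_inner, banach} \<Rightarrow>\<^sub>L 'b::real_inner). adjoint (blinfun_apply A))"
proof
  fix A B :: "'a \<Rightarrow>\<^sub>L 'b" and y z :: 'b and r :: real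
  show "adjoint (blinfun_apply (A + B)) y = adjoint A y + adjoint B y"
    by (rule vector_eq_ldot[THEN iffD1])
      (simp add: adjoint_blinfun inner_add_right inner_add_left blinfun.add_left)
  show "adjoint A (y + z) = adjoint A y + adjoint A z"
    by (rule vector_eq_ldot[THEN iffD1])
      (simp add: adjoint_blinfun inner_add_right)
  show "adjoint (blinfun_apply (r *\<^sub>R A)) y = r *\<^sub>R adjoint A y"
    by (rule vector_eq_ldot[THEN iffD1])
      (simp add: adjoint_blinfun blinfun.scaleR_left)
  show "adjoint A (r *\<^sub>R y) = r *\<^sub>R adjoint A y"
    by (rule vector_eq_ldot[THEN iffD1])
      (simp add: adjoint_blinfun)
next
  have "norm (adjoint (blinfun_apply A) y) \<le> norm A * norm y * 1" for A :: "'a \<Rightarrow>\<^sub>L 'b" and y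
  proof -
    let ?g = "adjoint (blinfun_apply A) y"
    have "norm ?g * norm ?g = A ?g \<bullet> y"
      by (metis adjoint_blinfun power2_eq_square power2_norm_eq_inner)
    also have "\<dots> \<le> norm (A ?g) * norm y" by (rule norm_cauchy_schwarz)
    also have "\<dots> \<le> (norm A * norm ?g) * norm y"
      by (intro mult_right_mono norm_blinfun) simp
    finally have "norm ?g * norm ?g \<le> (norm A * norm y) * norm ?g" by (simp add: ac_simps)
    then show ?thesis
      by (cases "norm ?g = 0") (simp_all add: mult_le_cancel_right)
  qed
  then show "\<exists>K. \<forall>(A :: 'a \<Rightarrow>\<^sub>L 'b) y. norm (adjoint (blinfun_apply A) y) \<le> norm A * norm y * K"
    by blast
qed

lemma le_stopping_index_iff:
  "enat k \<le> stopping_index F F' \<eta> \<theta> x0 \<tau> \<delta> yd \<longleftrightarrow>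
    (\<forall>j<k. norm (F (relaxed_PLW F F' \<eta> \<theta> x0 \<delta> yd j) - yd) > \<tau> * \<delta>)"
  (is "_ \<longleftrightarrow> ?P k")
proof
  assume le: "enat k \<le> stopping_index F F' \<eta> \<theta> x0 \<tau> \<delta> yd"
  show "?P k"
  proof (rule ccontr)
    assume neg: "\<not> ?P k"
    \<comment> \<open>Admissibility passes to smaller indices, so an inadmissible \<open>k\<close>
      exceeds every admissible index. As 0 is vacuously admissible, \<open>k\<close> has a
      predecessor, and this bounds the supremum.\<close>
    have less: "i < k" if "?P i" for i
      using that neg by (meson less_le_trans not_less)
    obtain l where l: "k = Suc l" using neg by (cases k) auto
    have "stopping_index F F' \<eta> \<theta> x0 \<tau> \<delta> yd \<le> enat l"
      unfolding stopping_index_def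
      by (rule Sup_least) (use less l in \<open>force simp: less_Suc_eq_le\<close>)
    with le l show False by (metis Suc_n_not_le_n enat_ord_simps(1) order.trans)
  qed
next
  assume "?P k"
  then show "enat k \<le> stopping_index F F' \<eta> \<theta> x0 \<tau> \<delta> yd"
    unfolding stopping_index_def by (intro Sup_upper) auto
qed

text \<open>\<open>F' x (x - xs)\<close> is the residual plus a noise error of size at most \<delta>
  and a linearisation error of size at most \<eta>(|r| + \<delta>); pair it with the residual.
  Geometrically, \<open>xs\<close> lies in a half-space, and when \<open>p_noisy\<close> is positive
  the step with \<theta> = 1 projects onto its boundary.\<close>

lemma p_noisy_le_inner:
  fixes F :: "'a::{real_inner, banach} \<Rightarrow> 'b::real_inner"
  assumes cone: "norm (F xs - F x - blinfun_apply (F' x) (xs - x)) \<le> \<eta> * norm (F xs - F x)"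
    and "0 \<le> \<eta>" and noise: "norm (yd - F xs) \<le> \<delta>"
  shows "p_noisy \<eta> \<delta> (norm (F x - yd)) \<le> (x - xs) \<bullet> residual_gradient F F' yd x"
proof -
  define r e where "r = F x - yd" and "e = F xs - F x - blinfun_apply (F' x) (xs - x)"
  have "norm (F xs - F x) \<le> norm r + \<delta>"
    using noise norm_triangle_ineq[of "F x - yd" "yd - F xs"]
    by (simp add: r_def norm_minus_commute)
  then have e: "norm e \<le> \<eta> * (norm r + \<delta>)"
    using cone \<open>0 \<le> \<eta>\<close> unfolding e_def by (meson mult_left_mono order.trans)
  have "(x - xs) \<bullet> residual_gradient F F' yd x = blinfun_apply (F' x) (x - xs) \<bullet> r"
    by (simp add: residual_gradient_def adjoint_blinfun r_def)
  also have "blinfun_apply (F' x) (x - xs) = r + (yd - F xs) + e"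
    by (simp add: r_def e_def blinfun.diff_right)
  also have "(r + (yd - F xs) + e) \<bullet> r = (norm r)\<^sup>2 + (yd - F xs) \<bullet> r + e \<bullet> r"
    by (simp add: inner_add_left power2_norm_eq_inner)
  finally have eq: "(x - xs) \<bullet> residual_gradient F F' yd x =
    (norm r)\<^sup>2 + (yd - F xs) \<bullet> r + e \<bullet> r" .
  have "\<bar>(yd - F xs) \<bullet> r\<bar> \<le> \<delta> * norm r"
    using Cauchy_Schwarz_ineq2[of "yd - F xs" r] mult_right_mono[OF noise, of "norm r"] by simp
  moreover have "\<bar>e \<bullet> r\<bar> \<le> \<eta> * (norm r + \<delta>) * norm r"
    using Cauchy_Schwarz_ineq2[of e r] mult_right_mono[OF e, of "norm r"] by simp
  ultimately show ?thesis
    unfolding eq p_noisy_def r_def[symmetric] by (simp add: algebra_simps power2_eq_square)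
qed

text \<open>With \<open>t\<close> the step factor, the squared norm drops by t (2 <d, g> - \<theta>
  p), which is at least t (2 - \<theta>) p.\<close>

lemma relaxed_projection_step_norm_le:
  fixes d g :: "'a::real_inner"
  assumes p: "0 \<le> p" "p \<le> d \<bullet> g" and \<theta>: "0 \<le> \<theta>" "\<theta> \<le> 2"
  shows "norm (d - (\<theta> * (p / (norm g)\<^sup>2)) *\<^sub>R g) \<le> norm d"
proof (cases "g = 0")
  case False
  define t where "t = \<theta> * (p / (norm g)\<^sup>2)"
  have t: "0 \<le> t" using p \<theta> by (simp add: t_def)
  have "(norm (d - t *\<^sub>R g))\<^sup>2 = (norm d)\<^sup>2 - t * (2 * (d \<bullet> g) - t * (norm g)\<^sup>2)"
    by (simp add: power2_norm_eq_inner inner_diff_left inner_diff_right inner_commute algebra_simps)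
  also have "t * (norm g)\<^sup>2 = \<theta> * p" using False by (simp add: t_def)
  also have "(norm d)\<^sup>2 - t * (2 * (d \<bullet> g) - \<theta> * p) \<le> (norm d)\<^sup>2"
    using t p mult_right_mono[OF \<theta>(2) p(1)] by simp
  finally show ?thesis unfolding t_def by (rule power2_le_imp_le) simp
qed simp

theorem theorem4p4:
  fixes F :: "'a::{real_inner, banach} \<Rightarrow> 'b::{real_inner, banach}"
    and F' :: "'a \<Rightarrow> 'a \<Rightarrow>\<^sub>L 'b"
    and D :: "'a set"
    and x0 xs :: 'a
    and y :: 'b
    and C \<rho> \<eta> \<delta> \<tau> :: real
    and \<theta> :: "nat \<Rightarrow> real"
    and k :: nat
  assumes A1_domain: "continuous_on D F" "interior D \<noteq> {}" "x0 \<in> D"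
    and A1_const: "C > 0" "\<rho> > 0"
    and A1_ball: "ball x0 \<rho> \<subseteq> D"
    and A1_deriv: "\<And>x. x \<in> ball x0 \<rho> \<Longrightarrow> has_gateaux_derivative F (F' x) x"
    and A1_bound: "\<And>x. x \<in> ball x0 \<rho> \<Longrightarrow> norm (F' x) \<le> C"
    and A2_eta: "\<eta> < 1"
    and A2_cone: "\<And>x x'. x \<in> ball x0 \<rho> \<Longrightarrow> x' \<in> ball x0 \<rho> \<Longrightarrow>
      norm (F x' - F x - blinfun_apply (F' x) (x' - x)) \<le> \<eta> * norm (F x' - F x)"
    and A3: "xs \<in> ball x0 (\<rho> / 2)" "F xs = y"
    and A4_deriv: "\<And>x. x \<in> ball x0 \<rho> \<Longrightarrow> (F has_derivative blinfun_apply (F' x)) (at x)"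
    and A4_cont: "continuous_on (ball x0 \<rho>) F'"
    and noise_level: "\<delta> > 0"
    and relaxation: "\<And>j. 0 < \<theta> j \<and> \<theta> j < 2"
    and tau: "\<tau> > (1 + \<eta>) / (1 - \<eta>)"
  shows "continuous_on
    {yd. norm (yd - y) \<le> \<delta> \<and> enat k \<le> stopping_index F F' \<eta> \<theta> x0 \<tau> \<delta> yd}
    (\<lambda>yd. relaxed_PLW F F' \<eta> \<theta> x0 \<delta> yd k)"
proof (cases "0 \<le> \<eta>")
  case True
  let ?x = "\<lambda>j yd. relaxed_PLW F F' \<eta> \<theta> x0 \<delta> yd j"
  let ?g = "\<lambda>yd x. residual_gradient F F' yd x"
  \<comment> \<open>The data sets shrink as \<open>j\<close> grows, so a bound or continuity known
    for iterate \<open>j\<close> on \<open>S j\<close> can be used on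
    \<open>S (Suc j)\<close>.\<close>
  define S where
    "S j = {yd. norm (yd - y) \<le> \<delta> \<and> enat j \<le> stopping_index F F' \<eta> \<theta> x0 \<tau> \<delta> yd}" for j
  have S_Suc: "S (Suc j) \<subseteq> S j" for j
    by (auto simp: S_def le_stopping_index_iff)
  \<comment> \<open>The radius \<rho>/2 in A3 enters here: the closed ball around \<open>xs\<close>
    through \<open>x0\<close> lies inside the \<rho>-ball around \<open>x0\<close>.\<close>
  have ball_xs: "x \<in> ball x0 \<rho>" if "norm (x - xs) \<le> norm (x0 - xs)" for x
    using that A3(1) dist_triangle[of x0 x xs] by (simp add: dist_norm norm_minus_commute)
  have xs: "xs \<in> ball x0 \<rho>" by (rule ball_xs) simp
  have p: "p_noisy \<eta> \<delta> (norm (F x - yd)) \<le> (x - xs) \<bullet> ?g yd x"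
    if "x \<in> ball x0 \<rho>" "norm (yd - y) \<le> \<delta>" for x yd
    by (rule p_noisy_le_inner) (use A2_cone[OF that(1) xs] True that(2) A3(2) in auto)
  \<comment> \<open>Membership in \<open>S (Suc j)\<close> is what makes residual \<open>j\<close>
    exceed \<tau>\<delta>, and \<tau>\<delta> lies beyond the larger root (1 + \<eta>)\<delta> / (1
    - \<eta>) of \<open>p_noisy\<close>.\<close>
  have p_pos: "0 < p_noisy \<eta> \<delta> (norm (F (?x j yd) - yd))" if "yd \<in> S (Suc j)" for j yd
  proof -
    let ?t = "norm (F (?x j yd) - yd)"
    have "\<tau> * \<delta> < ?t" using that by (auto simp: S_def le_stopping_index_iff)
    moreover have "(1 + \<eta>) / (1 - \<eta>) * \<delta> < \<tau> * \<delta>"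
      using tau noise_level by (rule mult_strict_right_mono)
    ultimately have t: "(1 + \<eta>) / (1 - \<eta>) * \<delta> < ?t" by linarith
    moreover have "0 \<le> (1 + \<eta>) / (1 - \<eta>) * \<delta>" using True A2_eta noise_level by simp
    ultimately have "0 < ?t" by linarith
    moreover have "0 < (1 - \<eta>) * ?t - (1 + \<eta>) * \<delta>"
      using t A2_eta by (simp add: field_simps)
    ultimately show ?thesis by (simp add: p_noisy_def)
  qed
  have dist_le: "yd \<in> S j \<Longrightarrow> norm (?x j yd - xs) \<le> norm (x0 - xs)" for j yd
  proof (induction j)
    case (Suc j)
    let ?p = "p_noisy \<eta> \<delta> (norm (F (?x j yd) - yd))"
    have IH: "norm (?x j yd - xs) \<le> norm (x0 - xs)" using Suc S_Suc by blast
    have "?p \<le> (?x j yd - xs) \<bullet> ?g yd (?x j yd)"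
      using p ball_xs[OF IH] Suc.prems by (auto simp: S_def)
    then have "norm (?x j yd - xs - (\<theta> j * (?p / (norm (?g yd (?x j yd)))\<^sup>2)) *\<^sub>R ?g yd (?x j yd))
        \<le> norm (?x j yd - xs)"
      using p_pos[OF Suc.prems] relaxation[of j] by (intro relaxed_projection_step_norm_le) auto
    with IH show ?case by (simp add: Let_def algebra_simps)
  qed simp
  have "continuous_on (S j) (?x j)" for j
  proof (induction j)
    case (Suc j)
    let ?S = "S (Suc j)"
    have cont_x: "continuous_on ?S (?x j)"
      using Suc S_Suc by (rule continuous_on_subset)
    have in_ball: "?x j yd \<in> ball x0 \<rho>" if "yd \<in> ?S" for yd
      using that S_Suc dist_le ball_xs by blast
    have cont_F: "continuous_on ?S (\<lambda>yd. F (?x j yd))"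
      by (rule continuous_on_compose2[OF A1_domain(1) cont_x]) (use in_ball A1_ball in blast)
    have cont_F': "continuous_on ?S (\<lambda>yd. F' (?x j yd))"
      by (rule continuous_on_compose2[OF A4_cont cont_x]) (use in_ball in blast)
    have cont_g: "continuous_on ?S (\<lambda>yd. ?g yd (?x j yd))"
      unfolding residual_gradient_def
      by (intro bounded_bilinear.continuous_on[OF bounded_bilinear_adjoint_blinfun]
          cont_F cont_F' continuous_intros)
    \<comment> \<open>A zero gradient would make the inner product bounding \<open>p_noisy\<close>
      vanish, against its positivity. So the quotient in the step is continuous.\<close>
    have g_nz: "?g yd (?x j yd) \<noteq> 0" if "yd \<in> ?S" for yd
    proof
      assume "?g yd (?x j yd) = 0"
      then show False
        using p[OF in_ball[OF that], of yd] p_pos[OF that] that by (simp add: S_def)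
    qed
    show ?case
      unfolding relaxed_PLW.simps Let_def p_noisy_def
      by (intro continuous_intros cont_x cont_g cont_F) (use g_nz in simp)
  qed simp
  then show ?thesis by (simp add: S_def)
next
  case False
  have x0: "x0 \<in> ball x0 \<rho>" using A1_const by simp
  have "blinfun_apply (F' x0) h = 0" for h
  proof -
    \<comment> \<open>The scale keeps \<open>x0 + s *\<^sub>R h\<close> in the ball; the added 1
      covers \<open>h = 0\<close>. With \<eta> negative the cone condition forces both of its sides
      to be zero there.\<close>
    define s where "s = \<rho> / (2 * (norm h + 1))"
    have s: "s > 0" using A1_const by (simp add: s_def add_nonneg_pos)
    have "s * norm h < s * (2 * (norm h + 1))"
      using s by (intro mult_strict_left_mono) (auto simp: add_nonneg_pos)
    also have "\<dots> = \<rho>" by (simp add: s_def add_nonneg_eq_0_iff)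
    finally have ball: "x0 + s *\<^sub>R h \<in> ball x0 \<rho>" using s by (simp add: dist_norm)
    have cone: "norm (F (x0 + s *\<^sub>R h) - F x0 - s *\<^sub>R blinfun_apply (F' x0) h)
        \<le> \<eta> * norm (F (x0 + s *\<^sub>R h) - F x0)"
      using A2_cone[OF x0 ball] by (simp add: blinfun.scaleR_right)
    then have "0 \<le> \<eta> * norm (F (x0 + s *\<^sub>R h) - F x0)" by (rule order_trans[OF norm_ge_zero])
    then have "F (x0 + s *\<^sub>R h) - F x0 = 0" using False by (simp add: zero_le_mult_iff)
    with cone show ?thesis using s by (simp add: mult_le_0_iff)
  qed
  then have "residual_gradient F F' yd x0 = 0" for yd
    by (subst inner_eq_zero_iff[symmetric]) (simp add: residual_gradient_def adjoint_blinfun)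
  then have "relaxed_PLW F F' \<eta> \<theta> x0 \<delta> yd j = x0" for yd j
    by (induction j) (simp_all add: Let_def)
  then show ?thesis by simp
qed

end
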